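(* Fix an integer $m\ge 2$ and a bounded open connected subset $\Omega\subset\mathbb{R}^m$. There exist $d=5$ smooth bounded vector fields $V_1,\ldots,V_5$ on $\mathbb{R}^m$ such that the control system \[ \frac{d}{dt}X_t = u^1_tV_1(X_t)+\cdots+u^5_tV_5(X_t),\qquad t\in[0,1], \] is a universal $N$-point interpolator on $\Omega$ for every $N\in\mathbb{N}$.
   Context: A vector field on $\mathbb{R}^m$ is a map $\mathbb{R}^m\to\mathbb{R}^m$; it is bounded if $\sup_{x\in\mathbb{R}^m}\|V(x)\|<\infty$. The controls $u^1,\ldots,u^d$ are real-valued (square-integrable) functions on $[0,1]$; for smooth bounded vector fields the solution of the control system with initial condition $X_0=x$ exists and is unique and is denoted $X^x_t$. The system $\frac{d}{dt}X_t=\sum_{i=1}^d u^i_tV_i(X_t)$ is called a universal $N$-point interpolator on $\Omega$ if for every collection $\{(x_i,y_i)\in\Omega\times\Omega: i=1,\ldots,N\}$ with $x_1,\ldots,x_N$ pairwise distinct and $y_1,\ldots,y_N$ pairwise distinct, there exist controls $u^1,\ldots,u^d$ such that $X^{x_i}_1=y_i$ for all $i=1,\ldots,N$. *)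

theory Defs
  imports "HOL-Analysis.Analysis"
begin

fun Ck :: "nat \<Rightarrow> ('a::euclidean_space \<Rightarrow> 'b::real_normed_vector) \<Rightarrow> bool" where
  "Ck 0 f \<longleftrightarrow> continuous_on UNIV f"
| "Ck (Suc k) f \<longleftrightarrow> (\<forall>x. f differentiable at x) \<and>
      (\<forall>v\<in>Basis. Ck k (\<lambda>x. frechet_derivative f (at x) v))"

definition smooth :: "('a::euclidean_space \<Rightarrow> 'b::real_normed_vector) \<Rightarrow> bool" where
  "smooth f \<longleftrightarrow> (\<forall>k. Ck k f)"

definition bounded_field :: "('a::real_normed_vector \<Rightarrow> 'a) \<Rightarrow> bool" where
  "bounded_field V \<longleftrightarrow> bounded (range V)"

definition square_integrable01 :: "(real \<Rightarrow> real) \<Rightarrow> bool" where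
  "square_integrable01 u \<longleftrightarrow> u measurable_on {0..1} \<and> (\<lambda>t. (u t)^2) integrable_on {0..1}"

definition ctrl_solution ::
  "nat \<Rightarrow> (nat \<Rightarrow> 'a::euclidean_space \<Rightarrow> 'a) \<Rightarrow> (nat \<Rightarrow> real \<Rightarrow> real) \<Rightarrow> 'a \<Rightarrow> (real \<Rightarrow> 'a) \<Rightarrow> bool" where
  "ctrl_solution d V u x X \<longleftrightarrow> X 0 = x \<and>
     (\<forall>t\<in>{0..1}. ((\<lambda>s. \<Sum>i<d. u i s *\<^sub>R V i (X s)) has_integral (X t - x)) {0..t})"

definition universal_interpolator ::
  "nat \<Rightarrow> (nat \<Rightarrow> 'a::euclidean_space \<Rightarrow> 'a) \<Rightarrow> nat \<Rightarrow> 'a set \<Rightarrow> bool" where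
  "universal_interpolator d V N \<Omega> \<longleftrightarrow>
     (\<forall>x y :: nat \<Rightarrow> 'a.
        (\<forall>i<N. x i \<in> \<Omega> \<and> y i \<in> \<Omega>) \<longrightarrow> inj_on x {..<N} \<longrightarrow> inj_on y {..<N} \<longrightarrow>
        (\<exists>u :: nat \<Rightarrow> real \<Rightarrow> real. (\<forall>j<d. square_integrable01 (u j)) \<and>
           (\<forall>i<N. (\<exists>X. ctrl_solution d V u (x i) X) \<and>
                   (\<forall>X. ctrl_solution d V u (x i) X \<longrightarrow> X 1 = y i))))"

end

theory Submission
  imports Defs "HOL-Real_Asymp.Real_Asymp"
begin

text \<open>Write \<open>x = (s, z)\<close> with \<open>s\<close> the coordinate along a unit vector \<open>e\<close> and \<open>z\<close> the remaining
  coordinates. Three fields suffice: the constant field \<open>e\<close>, the field \<open>W\<close> moving \<open>z\<close> by Gaussians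
  of distinct widths in \<open>s\<close>, and \<open>f e\<close> with \<open>f = exp (- |z|\<^sup>2)\<close>. Each is constant along its own
  trajectories, so its flow is an explicit shear. Conjugating the flow of \<open>W\<close> by translations along
  \<open>e\<close> yields all translates of the Gaussians, which are linearly independent; hence \<open>z\<close> can be shifted
  by an amount depending arbitrarily on \<open>s\<close>, for finitely many values of \<open>s\<close>. If the points have
  distinct \<open>s\<close>, \<open>f\<close> can be given any values in \<open>(0, 1]\<close> at the points, so that the flow of
  \<open>f e\<close> followed by a translation moves each \<open>s\<close> to its target, after which \<open>z\<close> is adjusted.
  Coinciding values of \<open>s\<close> are first separated by a generic flow of \<open>f e\<close>, and the targets
  are handled by time reversal. No trajectory needs to stay in \<open>\<Omega>\<close>.\<close>

subsection \<open>Interpolation by translates of Gaussians\<close>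

text \<open>The difference of the exponents is a polynomial in \<open>c\<close> tending to minus
  infinity: quadratic with leading coefficient \<open>l' - l\<close> if the rates differ, and linear
  with slope \<open>- 2 * l * (a - a')\<close> if they agree.\<close>

lemma gauss_quotient_tendsto_0:
  fixes l l' a a' :: real
  assumes "l' < l \<or> l' = l \<and> a' < a" and "0 < l'"
  shows "((\<lambda>c. exp (- l * (a + c)\<^sup>2) / exp (- l' * (a' + c)\<^sup>2)) \<longlongrightarrow> 0) at_top"
proof -
  have "filterlim (\<lambda>c. - l * (a + c)\<^sup>2 + l' * (a' + c)\<^sup>2) at_bot at_top"
    using assms(1)
  proof
    assume "l' < l"
    define d where "d = l - l'"
    have "d > 0" using \<open>l' < l\<close> d_def by simp
    have l: "l = l' + d" by (simp add: d_def)
    show ?thesis unfolding l using \<open>d > 0\<close> \<open>0 < l'\<close> by real_asymp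
  next
    assume *: "l' = l \<and> a' < a"
    define d where "d = l * (a - a')"
    have d: "d > 0" using * assms d_def by simp
    have "filterlim (\<lambda>c. - d * (a + a' + 2 * c)) at_bot at_top"
      using d by real_asymp
    moreover have "- l * (a + c)\<^sup>2 + l' * (a' + c)\<^sup>2 = - d * (a + a' + 2 * c)" for c
      using * by (simp add: d_def power2_eq_square algebra_simps)
    ultimately show ?thesis by simp
  qed
  then have "((\<lambda>c. exp (- l * (a + c)\<^sup>2 + l' * (a' + c)\<^sup>2)) \<longlongrightarrow> 0) at_top"
    by (rule filterlim_compose[OF exp_at_bot])
  moreover have "exp (- l * (a + c)\<^sup>2 + l' * (a' + c)\<^sup>2) =
      exp (- l * (a + c)\<^sup>2) / exp (- l' * (a' + c)\<^sup>2)" for c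
    by (simp flip: exp_diff)
  ultimately show ?thesis by simp
qed

text \<open>An index is a pair of a shift and a label choosing the rate. As \<open>c\<close> grows,
  one term dominates all others: the one of least rate and, among these, of least shift. Dividing
  the relation by it and passing to the limit isolates its coefficient.\<close>

lemma gauss_translates_independent:
  fixes l :: "'b \<Rightarrow> real" and \<mu> :: "real \<times> 'b \<Rightarrow> real"
  assumes "finite P" and inj: "inj_on l (snd ` P)" and pos: "\<And>p. p \<in> P \<Longrightarrow> 0 < l (snd p)"
    and zero: "\<And>c. (\<Sum>p\<in>P. \<mu> p * exp (- l (snd p) * (fst p + c)\<^sup>2)) = 0"
    and "p \<in> P"
  shows "\<mu> p = 0"
proof (rule ccontr)
  assume "\<mu> p \<noteq> 0"
  \<comment> \<open>Only indices with nonzero coefficients are kept, so that the vanishing of the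
    dominant coefficient is a contradiction.\<close>
  define Q where "Q = {p \<in> P. \<mu> p \<noteq> 0}"
  have "p \<in> Q" using \<open>p \<in> P\<close> \<open>\<mu> p \<noteq> 0\<close> by (simp add: Q_def)
  then have "Q \<noteq> {}" by blast
  have Q: "finite Q" "Q \<subseteq> P" using \<open>finite P\<close> by (auto simp: Q_def)
  define L where "L = Min ((l \<circ> snd) ` Q)"
  define Q' where "Q' = {q \<in> Q. l (snd q) = L}"
  have "L \<in> (l \<circ> snd) ` Q" unfolding L_def using Q(1) \<open>Q \<noteq> {}\<close> by (intro Min_in) auto
  then obtain q where "q \<in> Q" "l (snd q) = L" using \<open>L \<in> _\<close> by fastforce
  then have "q \<in> Q'" by (simp add: Q'_def)
  then have "Q' \<noteq> {}" by blast
  have "finite Q'" using Q(1) by (simp add: Q'_def)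
  define a where "a = Min (fst ` Q')"
  have "a \<in> fst ` Q'" unfolding a_def using \<open>finite Q'\<close> \<open>Q' \<noteq> {}\<close> by (intro Min_in) simp_all
  then obtain p0 where p0: "p0 \<in> Q'" "fst p0 = a" by blast
  have p0Q: "p0 \<in> Q" "l (snd p0) = L" "p0 \<in> P" using p0 Q by (auto simp: Q'_def)
  have Lpos: "0 < L" using pos p0Q by metis
  let ?\<phi> = "\<lambda>p c. exp (- l (snd p) * (fst p + c)\<^sup>2)"
  have lim: "((\<lambda>c. ?\<phi> q c / ?\<phi> p0 c) \<longlongrightarrow> (if q = p0 then 1 else 0)) at_top"
    if q: "q \<in> Q" for q
  proof (cases "q = p0")
    case False
    have "L \<le> l (snd q)" unfolding L_def using q Q by auto
    moreover have "a < fst q" if "l (snd q) = L"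
    proof -
      have "q \<in> Q'" using q that by (simp add: Q'_def)
      then have "a \<le> fst q" unfolding a_def using \<open>finite Q'\<close> by simp
      \<comment> \<open>Rates determine labels, so distinct indices of the same rate must differ in
        their shifts.\<close>
      moreover have "snd q = snd p0"
        using inj that p0Q q Q by (metis imageI inj_onD subsetD)
      then have "fst q \<noteq> a" using False p0 by (metis prod_eqI)
      ultimately show ?thesis by simp
    qed
    ultimately have "L < l (snd q) \<or> L = l (snd q) \<and> a < fst q" by force
    then show ?thesis
      using gauss_quotient_tendsto_0[of L "l (snd q)" a "fst q"] Lpos False p0 p0Q by simp
  qed simp
  have "((\<lambda>c. \<Sum>q\<in>Q. \<mu> q * (?\<phi> q c / ?\<phi> p0 c)) \<longlongrightarrow>
      (\<Sum>q\<in>Q. \<mu> q * (if q = p0 then 1 else 0))) at_top"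
    by (intro tendsto_sum tendsto_mult tendsto_const lim)
  moreover have "(\<Sum>q\<in>Q. \<mu> q * (?\<phi> q c / ?\<phi> p0 c)) = 0" for c
  proof -
    have "(\<Sum>q\<in>Q. \<mu> q * ?\<phi> q c) = (\<Sum>q\<in>P. \<mu> q * ?\<phi> q c)"
      using Q \<open>finite P\<close> by (intro sum.mono_neutral_left) (auto simp: Q_def)
    then show ?thesis using zero[of c]
      by (simp add: sum_divide_distrib[symmetric])
  qed
  moreover have "(\<Sum>q\<in>Q. \<mu> q * (if q = p0 then 1 else 0)) = \<mu> p0"
    using Q p0Q by (simp add: if_distrib cong: if_cong)
  ultimately have "((\<lambda>c::real. 0::real) \<longlongrightarrow> \<mu> p0) at_top" by simp
  then have "\<mu> p0 = 0" by (simp add: tendsto_const_iff)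
  then show False using p0Q by (simp add: Q_def)
qed

text \<open>Induction on \<open>P\<close>: if every \<open>k\<close> in \<open>R\<close> vanishing on \<open>Q\<close> also vanished at the new index \<open>p\<close>, then
  expanding in elements \<open>D q\<close> of \<open>R\<close> dual to \<open>Q\<close> would make \<open>\<phi> p\<close> a combination of the \<open>\<phi> q\<close>.\<close>

lemma interpolation_of_independent:
  fixes \<phi> :: "'p \<Rightarrow> 'c \<Rightarrow> real" and R :: "('p \<Rightarrow> real) \<Rightarrow> bool"
  assumes "finite P"
    and gen: "\<And>c. R (\<lambda>p. \<phi> p c)"
    and add: "\<And>g h. R g \<Longrightarrow> R h \<Longrightarrow> R (\<lambda>p. g p + h p)"
    and scale: "\<And>s h. R h \<Longrightarrow> R (\<lambda>p. s * h p)"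
    and indep: "\<And>\<mu>. (\<And>c. (\<Sum>p\<in>P. \<mu> p * \<phi> p c) = 0) \<Longrightarrow> \<forall>p\<in>P. \<mu> p = 0"
  shows "\<exists>h. R h \<and> (\<forall>p\<in>P. h p = \<tau> p)"
proof -
  have zero: "R (\<lambda>p. 0)" using scale[OF gen, of 0] by simp
  have comb: "R (\<lambda>p. \<Sum>q\<in>Q. h q p)" if "finite Q" "\<And>q. q \<in> Q \<Longrightarrow> R (h q)" for Q :: "'p set" and h
    using that by (induction Q rule: finite_induct) (simp_all add: zero add)
  have main: "\<exists>h. R h \<and> (\<forall>p\<in>Q. h p = \<tau> p)" if "finite Q" "Q \<subseteq> P" for Q \<tau>
    using that
  proof (induction Q arbitrary: \<tau> rule: finite_induct)
    case empty
    then show ?case using zero by blast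
  next
    case (insert p Q)
    have IH: "\<exists>h. R h \<and> (\<forall>p\<in>Q. h p = \<tau> p)" for \<tau> using insert by blast
    have "\<exists>k. R k \<and> (\<forall>q\<in>Q. k q = 0) \<and> k p \<noteq> 0"
    proof (rule ccontr)
      assume neg: "\<nexists>k. R k \<and> (\<forall>q\<in>Q. k q = 0) \<and> k p \<noteq> 0"
      have "\<exists>D. \<forall>q. R (D q) \<and> (\<forall>r\<in>Q. D q r = (if r = q then 1 else 0))"
        by (intro choice allI IH)
      then obtain D where D: "\<And>q. R (D q)" "\<And>q r. r \<in> Q \<Longrightarrow> D q r = (if r = q then 1 else 0)"
        by blast
      \<comment> \<open>Coefficients of the relation expressing \<open>\<phi> p\<close> through the
        \<open>\<phi> q\<close> with weights \<open>D q p\<close>, extended by 0 to the rest of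
        \<open>P\<close>.\<close>
      define \<mu> where "\<mu> = (\<lambda>q. if q = p then 1 else if q \<in> Q then - D q p else 0)"
      have "(\<Sum>q\<in>P. \<mu> q * \<phi> q c) = 0" for c
      proof -
        \<comment> \<open>The generator at \<open>c\<close> minus its interpolant on
          \<open>Q\<close>. It vanishes on \<open>Q\<close>, hence by \<open>neg\<close> also at
          \<open>p\<close>, which is the desired relation at \<open>c\<close>.\<close>
        define k where "k = (\<lambda>r. \<phi> r c + (-1) * (\<Sum>q\<in>Q. \<phi> q c * D q r))"
        have "R k" unfolding k_def
          using insert(1) D(1) by (intro add gen scale comb)
        moreover have "k r = 0" if "r \<in> Q" for r
        proof -
          have "(\<Sum>q\<in>Q. \<phi> q c * D q r) = (\<Sum>q\<in>Q. if r = q then \<phi> q c else 0)"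
            using D(2)[OF that] by (intro sum.cong) auto
          then show ?thesis using insert(1) that by (simp add: k_def)
        qed
        ultimately have "k p = 0" using neg by blast
        have "(\<Sum>q\<in>P. \<mu> q * \<phi> q c) = (\<Sum>q\<in>insert p Q. \<mu> q * \<phi> q c)"
          using insert.prems \<open>finite P\<close>
          by (intro sum.mono_neutral_right) (auto simp: \<mu>_def)
        also have "\<dots> = \<phi> p c + (\<Sum>q\<in>Q. \<mu> q * \<phi> q c)"
          using insert by (simp add: \<mu>_def)
        also have "(\<Sum>q\<in>Q. \<mu> q * \<phi> q c) = (\<Sum>q\<in>Q. - (\<phi> q c * D q p))"
          using insert by (intro sum.cong) (auto simp: \<mu>_def)
        finally show ?thesis using \<open>k p = 0\<close> by (simp add: k_def sum_negf)
      qed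
      then have "\<mu> p = 0" using indep insert.prems by blast
      then show False by (simp add: \<mu>_def)
    qed
    then obtain k where k: "R k" "\<forall>q\<in>Q. k q = 0" "k p \<noteq> 0" by blast
    obtain h where h: "R h" "\<forall>q\<in>Q. h q = \<tau> q" using IH by blast
    let ?h = "\<lambda>r. h r + (\<tau> p - h p) / k p * k r"
    have "R ?h" by (intro add scale h k)
    moreover have "\<forall>q\<in>insert p Q. ?h q = \<tau> q" using h k by auto
    ultimately show ?case by blast
  qed
  show ?thesis using main[OF \<open>finite P\<close>] by blast
qed

subsection \<open>Smoothness of elementary functions\<close>

text \<open>A class containing the coefficients of the fields and stable under directional
  derivatives, so that derivatives of all orders are treated at once.\<close>

inductive elementary :: "('a::euclidean_space \<Rightarrow> real) \<Rightarrow> bool" where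
  const: "elementary (\<lambda>x. c)"
| inner: "elementary (\<lambda>x. x \<bullet> b)"
| add: "elementary f \<Longrightarrow> elementary g \<Longrightarrow> elementary (\<lambda>x. f x + g x)"
| mult: "elementary f \<Longrightarrow> elementary g \<Longrightarrow> elementary (\<lambda>x. f x * g x)"
| exp: "elementary f \<Longrightarrow> elementary (\<lambda>x. exp (f x))"

lemma elementary_sum:
  assumes "finite A" "\<And>i. i \<in> A \<Longrightarrow> elementary (f i)"
  shows "elementary (\<lambda>x. \<Sum>i\<in>A. f i x)"
  using assms by (induction A rule: finite_induct) (simp_all add: elementary.const elementary.add)

lemma elementary_has_derivative:
  assumes "elementary f"
  shows "\<exists>f'. (\<forall>x. (f has_derivative f' x) (at x)) \<and> (\<forall>v. elementary (\<lambda>x. f' x v))"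
  using assms
proof induction
  case (const c)
  show ?case by (intro exI[of _ "\<lambda>x v. 0"] conjI allI elementary.const has_derivative_const)
next
  case (inner b)
  show ?case
    by (intro exI[of _ "\<lambda>x v. v \<bullet> b"] conjI allI elementary.const
        has_derivative_inner_left has_derivative_ident)
next
  case (add f g)
  then obtain f' g' where "\<And>x. (f has_derivative f' x) (at x)" "\<And>v. elementary (\<lambda>x. f' x v)"
    "\<And>x. (g has_derivative g' x) (at x)" "\<And>v. elementary (\<lambda>x. g' x v)" by blast
  then show ?case
    by (intro exI[of _ "\<lambda>x v. f' x v + g' x v"] conjI allI elementary.add has_derivative_add)
next
  case (mult f g)
  then obtain f' g' where "\<And>x. (f has_derivative f' x) (at x)" "\<And>v. elementary (\<lambda>x. f' x v)"
    "\<And>x. (g has_derivative g' x) (at x)" "\<And>v. elementary (\<lambda>x. g' x v)" by blast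
  with mult show ?case
    by (intro exI[of _ "\<lambda>x v. f x * g' x v + f' x v * g x"] conjI allI elementary.add
        elementary.mult has_derivative_mult)
next
  case (exp f)
  then obtain f' where "\<And>x. (f has_derivative f' x) (at x)" "\<And>v. elementary (\<lambda>x. f' x v)"
    by blast
  with exp show ?case
    by (intro exI[of _ "\<lambda>x v. exp (f x) * f' x v"] conjI allI elementary.mult elementary.exp
        has_derivative_compose[of f, OF _ DERIV_exp[unfolded has_field_derivative_def]])
qed

text \<open>A directional derivative is again such a sum with the same vectors \<open>w b\<close>
  and new elementary coefficients; hence the induction on \<open>k\<close> with
  \<open>\<phi>\<close> arbitrary.\<close>

lemma smooth_sum_elementary:
  assumes "finite B" "\<And>b. b \<in> B \<Longrightarrow> elementary (\<phi> b)"
  shows "smooth (\<lambda>x. \<Sum>b\<in>B. \<phi> b x *\<^sub>R w b)"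
proof -
  have "Ck k (\<lambda>x. \<Sum>b\<in>B. \<phi> b x *\<^sub>R w b)" if "\<And>b. b \<in> B \<Longrightarrow> elementary (\<phi> b)" for k \<phi>
    using that
  proof (induction k arbitrary: \<phi>)
    case 0
    have "continuous_on UNIV (\<phi> b)" if "b \<in> B" for b
      using elementary_has_derivative[OF 0[OF that]] has_derivative_continuous
      by (blast intro: continuous_at_imp_continuous_on)
    then show ?case
      unfolding Ck.simps by (intro continuous_on_sum continuous_on_scaleR continuous_on_const)
  next
    case (Suc k)
    have "\<exists>\<phi>'. \<forall>b\<in>B. (\<forall>x. (\<phi> b has_derivative \<phi>' b x) (at x)) \<and> (\<forall>v. elementary (\<lambda>x. \<phi>' b x v))"
      by (intro bchoice ballI elementary_has_derivative Suc.prems)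
    then obtain \<phi>' where \<phi>': "\<And>b x. b \<in> B \<Longrightarrow> (\<phi> b has_derivative \<phi>' b x) (at x)"
      "\<And>b v. b \<in> B \<Longrightarrow> elementary (\<lambda>x. \<phi>' b x v)" by blast
    have der: "((\<lambda>x. \<Sum>b\<in>B. \<phi> b x *\<^sub>R w b) has_derivative (\<lambda>v. \<Sum>b\<in>B. \<phi>' b x v *\<^sub>R w b)) (at x)" for x
      by (intro has_derivative_sum has_derivative_scaleR_left \<phi>')
    then have "frechet_derivative (\<lambda>x. \<Sum>b\<in>B. \<phi> b x *\<^sub>R w b) (at x) = (\<lambda>v. \<Sum>b\<in>B. \<phi>' b x v *\<^sub>R w b)" for x
      by (rule frechet_derivative_at[symmetric])
    moreover have "Ck k (\<lambda>x. \<Sum>b\<in>B. \<phi>' b x v *\<^sub>R w b)" for v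
      by (intro Suc.IH \<phi>'(2))
    ultimately show ?case using der by (auto simp: differentiable_def)
  qed
  then show ?thesis using assms unfolding smooth_def by blast
qed

subsection \<open>Concatenation of controls\<close>

definition trajectory ::
  "nat \<Rightarrow> (nat \<Rightarrow> 'a::euclidean_space \<Rightarrow> 'a) \<Rightarrow> (nat \<Rightarrow> real \<Rightarrow> real) \<Rightarrow> real \<Rightarrow> real \<Rightarrow> 'a \<Rightarrow> (real \<Rightarrow> 'a) \<Rightarrow> bool" where
  "trajectory d V u a b x X \<longleftrightarrow> X a = x \<and>
     (\<forall>t\<in>{a..b}. ((\<lambda>s. \<Sum>i<d. u i s *\<^sub>R V i (X s)) has_integral (X t - x)) {a..t})"

text \<open>One control serves all starting points. Arbitrary time intervals and bounded Borel
  controls make the notion stable under concatenation.\<close>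

definition realizable :: "nat \<Rightarrow> (nat \<Rightarrow> 'a::euclidean_space \<Rightarrow> 'a) \<Rightarrow> ('a \<Rightarrow> 'a) \<Rightarrow> bool" where
  "realizable d V F \<longleftrightarrow> (\<forall>a b. a < b \<longrightarrow>
     (\<exists>u. (\<forall>j. u j \<in> borel_measurable borel \<and> bounded (range (u j))) \<and>
        (\<forall>x. (\<exists>X. trajectory d V u a b x X) \<and> (\<forall>X. trajectory d V u a b x X \<longrightarrow> X b = F x))))"

text \<open>Finitely many times do not affect the integrals; \<open>S\<close> absorbs the switching
  time of a concatenated control.\<close>

lemma trajectory_cong:
  assumes "trajectory d V u a b x X" "finite S" "a \<le> b"
    and "\<And>s i. s \<in> {a..b} - S \<Longrightarrow> i < d \<Longrightarrow> u i s = u' i s"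
    and "\<And>s. s \<in> {a..b} \<Longrightarrow> X s = X' s"
  shows "trajectory d V u' a b x X'"
  unfolding trajectory_def
proof (intro conjI ballI)
  show "X' a = x" using assms(1,3,5) by (force simp: trajectory_def)
  fix t assume t: "t \<in> {a..b}"
  have "((\<lambda>s. \<Sum>i<d. u i s *\<^sub>R V i (X s)) has_integral (X t - x)) {a..t}"
    using assms(1) t by (auto simp: trajectory_def)
  then have "((\<lambda>s. \<Sum>i<d. u' i s *\<^sub>R V i (X' s)) has_integral (X t - x)) {a..t}"
    using assms(4,5) t by (elim has_integral_spike_finite[OF \<open>finite S\<close>, rotated]) (auto intro!: sum.cong)
  then show "((\<lambda>s. \<Sum>i<d. u' i s *\<^sub>R V i (X' s)) has_integral (X' t - x)) {a..t}"
    using assms(5)[OF t] by simp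
qed

lemma trajectory_split:
  assumes "a \<le> m" "m \<le> b"
  shows "trajectory d V u a b x X \<longleftrightarrow> trajectory d V u a m x X \<and> trajectory d V u m b (X m) X"
proof (intro iffI conjI)
  let ?f = "\<lambda>s. \<Sum>i<d. u i s *\<^sub>R V i (X s)"
  assume *: "trajectory d V u a b x X"
  then show "trajectory d V u a m x X" using assms by (auto simp: trajectory_def)
  have "(?f has_integral X t - X m) {m..t}" if t: "t \<in> {m..b}" for t
  proof -
    have 1: "(?f has_integral X t - x) {a..t}" and 2: "(?f has_integral X m - x) {a..m}"
      using * t assms by (auto simp: trajectory_def)
    have "?f integrable_on {m..t}"
      by (rule integrable_on_subinterval[of ?f "{a..t}"]) (use 1 t assms in auto)
    then obtain J where J: "(?f has_integral J) {m..t}" by blast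
    have "(?f has_integral (X m - x) + J) {a..t}"
      using has_integral_combine[OF _ _ 2 J] t assms by simp
    with 1 have "X t - x = (X m - x) + J" by (rule has_integral_unique)
    then show ?thesis using J by (simp add: algebra_simps)
  qed
  then show "trajectory d V u m b (X m) X" by (simp add: trajectory_def)
next
  let ?f = "\<lambda>s. \<Sum>i<d. u i s *\<^sub>R V i (X s)"
  assume *: "trajectory d V u a m x X \<and> trajectory d V u m b (X m) X"
  have "(?f has_integral X t - x) {a..t}" if t: "t \<in> {a..b}" for t
  proof (cases "t \<le> m")
    case False
    then have "(?f has_integral X m - x) {a..m}" "(?f has_integral X t - X m) {m..t}"
      using * t assms by (auto simp: trajectory_def)
    then have "(?f has_integral (X m - x) + (X t - X m)) {a..t}"
      using False assms by (intro has_integral_combine[of a m t]) auto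
    then show ?thesis by simp
  qed (use * t in \<open>auto simp: trajectory_def\<close>)
  then show "trajectory d V u a b x X" using * by (simp add: trajectory_def)
qed

text \<open>The control for \<open>F\<close> runs on the first half of the interval and that for
  \<open>G\<close> on the second; existence and uniqueness of the endpoint both pass through
  \<open>trajectory_split\<close>.\<close>

lemma realizable_comp:
  assumes "realizable d V F" "realizable d V G"
  shows "realizable d V (\<lambda>x. G (F x))"
  unfolding realizable_def
proof (intro allI impI)
  fix a b :: real assume "a < b"
  define m where "m = (a + b) / 2"
  have m: "a < m" "m < b" using \<open>a < b\<close> by (auto simp: m_def)
  obtain u1 where u1: "\<And>j. u1 j \<in> borel_measurable borel" "\<And>j. bounded (range (u1 j))"
    "\<And>x. \<exists>X. trajectory d V u1 a m x X" "\<And>x X. trajectory d V u1 a m x X \<Longrightarrow> X m = F x"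
    using assms(1) m(1) unfolding realizable_def by meson
  obtain u2 where u2: "\<And>j. u2 j \<in> borel_measurable borel" "\<And>j. bounded (range (u2 j))"
    "\<And>x. \<exists>X. trajectory d V u2 m b x X" "\<And>x X. trajectory d V u2 m b x X \<Longrightarrow> X b = G x"
    using assms(2) m(2) unfolding realizable_def by meson
  define u where "u = (\<lambda>j s. if s < m then u1 j s else u2 j s)"
  show "\<exists>u. (\<forall>j. u j \<in> borel_measurable borel \<and> bounded (range (u j))) \<and>
        (\<forall>x. (\<exists>X. trajectory d V u a b x X) \<and> (\<forall>X. trajectory d V u a b x X \<longrightarrow> X b = G (F x)))"
  proof (intro exI[of _ u] conjI allI impI)
    fix j
    have "{s. s < m} \<in> sets borel" by simp
    then show "u j \<in> borel_measurable borel"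
      unfolding u_def using u1(1)[of j] u2(1)[of j] by (intro measurable_If) auto
    have "range (u j) \<subseteq> range (u1 j) \<union> range (u2 j)" by (auto simp: u_def)
    moreover have "bounded (range (u1 j) \<union> range (u2 j))" using u1(2) u2(2) by simp
    ultimately show "bounded (range (u j))" by (rule bounded_subset[rotated])
  next
    fix x
    obtain X1 where X1: "trajectory d V u1 a m x X1" using u1(3) by blast
    obtain X2 where X2: "trajectory d V u2 m b (X1 m) X2" using u2(3) by blast
    define X where "X = (\<lambda>s. if s \<le> m then X1 s else X2 s)"
    have "X2 m = X1 m" using X2 by (simp add: trajectory_def)
    then have eq: "X s = X2 s" if "s \<in> {m..b}" for s using that by (auto simp: X_def)
    \<comment> \<open>At \<open>m\<close> itself \<open>u\<close> already follows \<open>u2\<close>,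
      hence the exceptional point.\<close>
    have "trajectory d V u a m x X"
      by (rule trajectory_cong[OF X1, of "{m}"]) (use m in \<open>auto simp: u_def X_def\<close>)
    moreover have "trajectory d V u m b (X1 m) X"
      by (rule trajectory_cong[OF X2, of "{}"]) (use m eq in \<open>auto simp: u_def\<close>)
    ultimately show "\<exists>X. trajectory d V u a b x X"
      using trajectory_split[of a m b d V u x X] m by (auto simp: X_def)
  next
    fix x X assume "trajectory d V u a b x X"
    then have 1: "trajectory d V u a m x X" and 2: "trajectory d V u m b (X m) X"
      using trajectory_split[of a m b d V u x X] m by simp_all
    have "trajectory d V u1 a m x X"
      by (rule trajectory_cong[OF 1, of "{m}"]) (use m in \<open>auto simp: u_def\<close>)
    moreover have "trajectory d V u2 m b (X m) X"
      by (rule trajectory_cong[OF 2, of "{}"]) (use m in \<open>auto simp: u_def\<close>)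
    ultimately show "X b = G (F x)" using u1(4)[of x X] u2(4)[of "X m" X] by simp
  qed
qed

text \<open>A generalised shear \<open>V\<close> is constant along its own trajectories, so they are straight lines;
  uniqueness needs no Lipschitz estimate because the invariant \<open>P\<close> of \<open>V\<close> determines \<open>V\<close>.\<close>

lemma realizable_shear:
  fixes V :: "nat \<Rightarrow> 'a::euclidean_space \<Rightarrow> 'a"
  assumes "k < d" and P: "bounded_linear P" "\<And>x. P (V k x) = 0"
    and V: "\<And>x y. P x = P y \<Longrightarrow> V k x = V k y"
  shows "realizable d V (\<lambda>x. x + t *\<^sub>R V k x)"
  unfolding realizable_def
proof (intro allI impI)
  fix a b :: real assume "a < b"
  interpret P: bounded_linear P by fact
  \<comment> \<open>The constant speed that produces the displacement factor \<open>t\<close> in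
    time \<open>b - a\<close>.\<close>
  define c where "c = t / (b - a)"
  define u where "u = (\<lambda>j (s::real). if j = k then c else 0)"
  have sum: "(\<Sum>i<d. u i s *\<^sub>R V i y) = c *\<^sub>R V k y" for s y
    using \<open>k < d\<close> by (simp add: u_def if_distrib[of "\<lambda>r. r *\<^sub>R _"] cong: if_cong)
  show "\<exists>u. (\<forall>j. u j \<in> borel_measurable borel \<and> bounded (range (u j))) \<and>
        (\<forall>x. (\<exists>X. trajectory d V u a b x X) \<and>
          (\<forall>X. trajectory d V u a b x X \<longrightarrow> X b = x + t *\<^sub>R V k x))"
  proof (intro exI[of _ u] conjI allI impI)
    fix j
    show "u j \<in> borel_measurable borel" by (simp add: u_def)
    show "bounded (range (u j))" by (simp add: u_def)
  next
    fix x
    define X where "X = (\<lambda>s. x + ((s - a) * c) *\<^sub>R V k x)"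
    have "V k (X s) = V k x" for s
      by (rule V) (simp add: X_def P.add P.scaleR P)
    moreover have "((\<lambda>s. c *\<^sub>R V k x) has_integral (r - a) *\<^sub>R c *\<^sub>R V k x) {a..r}" if "a \<le> r" for r
      using has_integral_const_real[of "c *\<^sub>R V k x" a r] that by simp
    ultimately have "trajectory d V u a b x X"
      unfolding trajectory_def sum by (auto simp: X_def)
    then show "\<exists>X. trajectory d V u a b x X" by blast
  next
    fix x X assume X: "trajectory d V u a b x X"
    have int: "((\<lambda>s. c *\<^sub>R V k (X s)) has_integral X r - x) {a..r}" if "r \<in> {a..b}" for r
      using X that by (simp add: trajectory_def sum)
    have const: "V k (X r) = V k x" if "r \<in> {a..b}" for r
    proof (rule V)
      \<comment> \<open>Applying \<open>P\<close> to the integral equation annihilates the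
        integrand, so \<open>P\<close> is conserved along any trajectory.\<close>
      have "((P \<circ> (\<lambda>s. c *\<^sub>R V k (X s))) has_integral P (X r - x)) {a..r}"
        using has_integral_linear[OF int[OF that] P(1)] .
      moreover have "P \<circ> (\<lambda>s. c *\<^sub>R V k (X s)) = (\<lambda>s. 0)" by (simp add: fun_eq_iff P.scaleR P)
      ultimately have "P (X r - x) = 0" using has_integral_0_eq by fastforce
      then show "P (X r) = P x" by (simp add: P.diff)
    qed
    have "((\<lambda>s. c *\<^sub>R V k x) has_integral X b - x) {a..b}"
      by (rule has_integral_eq[OF _ int]) (use const \<open>a < b\<close> in auto)
    moreover have "((\<lambda>s. c *\<^sub>R V k x) has_integral (b - a) *\<^sub>R c *\<^sub>R V k x) {a..b}"
      using has_integral_const_real[of "c *\<^sub>R V k x" a b] \<open>a < b\<close> by simp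
    ultimately have "X b - x = (b - a) *\<^sub>R c *\<^sub>R V k x" by (rule has_integral_unique)
    moreover have "(b - a) * c = t" using \<open>a < b\<close> by (simp add: c_def)
    ultimately show "X b = x + t *\<^sub>R V k x" by (simp add: algebra_simps)
  qed
qed

lemma square_integrable01_bounded_borel:
  assumes "u \<in> borel_measurable borel" "bounded (range u)"
  shows "square_integrable01 u"
proof -
  obtain B where B: "\<And>s. \<bar>u s\<bar> \<le> B" using assms(2) by (auto simp: bounded_iff)
  have leb: "u \<in> borel_measurable (lebesgue_on {0..1})"
    using assms(1) by (simp add: borel_measurable_if_I measurable_completion measurable_restrict_space1)
  have "(\<lambda>t. (u t)\<^sup>2) integrable_on {0..1}"
  proof (rule measurable_bounded_by_integrable_imp_integrable)
    show "(\<lambda>t. (u t)\<^sup>2) \<in> borel_measurable (lebesgue_on {0..1})" using leb by simp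
    show "(\<lambda>t. B\<^sup>2) integrable_on {0..1::real}" by (rule integrable_const_ivl)
    show "norm ((u t)\<^sup>2) \<le> B\<^sup>2" for t using power_mono[OF B[of t] abs_ge_zero, of 2] by simp
  qed simp
  moreover have "u measurable_on {0..1}"
    using leb by (simp add: measurable_on_iff_borel_measurable)
  ultimately show ?thesis by (simp add: square_integrable01_def)
qed

lemma universal_interpolator_if_realizable:
  assumes "\<And>x y :: nat \<Rightarrow> 'a::euclidean_space. inj_on x {..<N} \<Longrightarrow> inj_on y {..<N} \<Longrightarrow>
    \<exists>F. realizable d V F \<and> (\<forall>i<N. F (x i) = y i)"
  shows "universal_interpolator d V N \<Omega>"
  unfolding universal_interpolator_def
proof (intro allI impI)
  fix x y :: "nat \<Rightarrow> 'a"
  assume "inj_on x {..<N}" "inj_on y {..<N}"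
  then obtain F where F: "realizable d V F" "\<forall>i<N. F (x i) = y i" using assms by blast
  obtain u where u: "\<And>j. u j \<in> borel_measurable borel" "\<And>j. bounded (range (u j))"
    "\<And>x. \<exists>X. trajectory d V u 0 1 x X" "\<And>x X. trajectory d V u 0 1 x X \<Longrightarrow> X 1 = F x"
    using F(1) zero_less_one[where 'a = real] unfolding realizable_def by meson
  have "ctrl_solution d V u x X \<longleftrightarrow> trajectory d V u 0 1 x X" for x X
    by (simp add: ctrl_solution_def trajectory_def)
  then show "\<exists>u. (\<forall>j<d. square_integrable01 (u j)) \<and>
           (\<forall>i<N. (\<exists>X. ctrl_solution d V u (x i) X) \<and>
                   (\<forall>X. ctrl_solution d V u (x i) X \<longrightarrow> X 1 = y i))"
    using u F(2) square_integrable01_bounded_borel by (intro exI[of _ u]) auto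
qed

section \<open>Compositions of flows of generalised shears\<close>

inductive flow_group :: "nat \<Rightarrow> (nat \<Rightarrow> 'a::real_vector \<Rightarrow> 'a) \<Rightarrow> ('a \<Rightarrow> 'a) \<Rightarrow> bool"
  for d V where
  flow: "k < d \<Longrightarrow> flow_group d V (\<lambda>x. x + t *\<^sub>R V k x)"
| comp: "flow_group d V F \<Longrightarrow> flow_group d V G \<Longrightarrow> flow_group d V (\<lambda>x. G (F x))"

locale shears =
  fixes d :: nat and V :: "nat \<Rightarrow> 'a::euclidean_space \<Rightarrow> 'a" and P :: "nat \<Rightarrow> 'a \<Rightarrow> 'a"
  assumes linear_P: "k < d \<Longrightarrow> bounded_linear (P k)"
    and P_V: "k < d \<Longrightarrow> P k (V k x) = 0"
    and V_cong: "k < d \<Longrightarrow> P k x = P k y \<Longrightarrow> V k x = V k y"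
begin

lemma V_flow: "k < d \<Longrightarrow> V k (x + t *\<^sub>R V k x) = V k x"
  by (rule V_cong) (simp_all add: linear_P[THEN bounded_linear.linear, THEN linear_add]
      linear_P[THEN bounded_linear.linear, THEN linear_cmul] P_V)

lemma flow_group_realizable: "flow_group d V F \<Longrightarrow> realizable d V F"
proof (induction rule: flow_group.induct)
  case (flow k t)
  show ?case
  proof (rule realizable_shear[where P = "P k"])
    show "P k (V k x) = 0" for x using flow by (rule P_V)
    show "V k x = V k y" if "P k x = P k y" for x y using flow that by (rule V_cong)
  qed (fact flow linear_P[OF flow])+
next
  case (comp F G)
  show ?case by (rule realizable_comp[OF comp.IH])
qed

text \<open>\<open>V k\<close> takes the same value at both ends of its flow line, so the parameter
  \<open>- t\<close> undoes \<open>t\<close>. Thus \<open>flow_group\<close>, introduced only as a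
  semigroup, contains inverses.\<close>

lemma flow_group_left_inverse:
  "flow_group d V F \<Longrightarrow> \<exists>G. flow_group d V G \<and> (\<forall>x. G (F x) = x)"
proof (induction rule: flow_group.induct)
  case (flow k t)
  show ?case
    using flow_group.flow[OF flow, of V "- t"] V_flow[OF flow] by (intro exI conjI) auto
next
  case (comp F G)
  then obtain F' G' where "flow_group d V F'" "\<forall>x. F' (F x) = x"
    "flow_group d V G'" "\<forall>x. G' (G x) = x" by blast
  then show ?case by (intro exI[of _ "\<lambda>x. F' (G' x)"]) (simp add: flow_group.comp)
qed

lemma flow_group_inj: "flow_group d V F \<Longrightarrow> inj F"
  using flow_group_left_inverse by (metis injI)

end

subsection \<open>The vector fields\<close>

text \<open>\<open>l b\<close> is the decay rate of the Gaussian in direction \<open>b\<close>.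
  Distinct rates give independence of the translates, and the dimension bound provides a direction
  transversal to \<open>e\<close>.\<close>

locale gauss_fields =
  fixes e :: "'a::euclidean_space" and l :: "'a \<Rightarrow> real"
  assumes e: "e \<in> Basis" and DIM_ge_2: "DIM('a) \<ge> 2"
    and inj_l: "inj_on l Basis" and l_pos: "b \<in> Basis \<Longrightarrow> 0 < l b"
begin

abbreviation B :: "'a set" where "B \<equiv> Basis - {e}"

definition W :: "'a \<Rightarrow> 'a" where "W x = (\<Sum>b\<in>B. exp (- l b * (x \<bullet> e)\<^sup>2) *\<^sub>R b)"

definition f :: "'a \<Rightarrow> real" where "f x = exp (- (\<Sum>b\<in>B. (x \<bullet> b)\<^sup>2))"

text \<open>The indices 3 and 4 are filled with the zero field to make up five fields.\<close>

definition V :: "nat \<Rightarrow> 'a \<Rightarrow> 'a" where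
  "V k x = (if k = 0 then e else if k = 1 then W x else if k = 2 then f x *\<^sub>R e else 0)"

text \<open>Linear invariants of the fields: \<open>W\<close> depends only on the
  \<open>e\<close>-coordinate and \<open>f\<close> only on the others; for a constant field the zero
  map serves.\<close>

definition P :: "nat \<Rightarrow> 'a \<Rightarrow> 'a" where
  "P k x = (if k = 1 then (x \<bullet> e) *\<^sub>R e else if k = 2 then x - (x \<bullet> e) *\<^sub>R e else 0)"

lemma e_simps [simp]: "e \<bullet> e = 1" "b \<in> B \<Longrightarrow> e \<bullet> b = 0" "b \<in> B \<Longrightarrow> b \<bullet> e = 0"
  using e by (auto simp: inner_Basis)

lemma sum_B_inner [simp]: "(\<Sum>b\<in>B. c b *\<^sub>R b) \<bullet> e = 0"
  by (simp add: inner_sum_left)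

lemma decomp: "x = (x \<bullet> e) *\<^sub>R e + (\<Sum>b\<in>B. (x \<bullet> b) *\<^sub>R b)"
proof -
  have "x = (\<Sum>b\<in>Basis. (x \<bullet> b) *\<^sub>R b)" by (simp add: euclidean_representation)
  also have "\<dots> = (x \<bullet> e) *\<^sub>R e + (\<Sum>b\<in>B. (x \<bullet> b) *\<^sub>R b)"
    using e by (simp add: sum.remove)
  finally show ?thesis .
qed

lemma W_inner [simp]: "W x \<bullet> e = 0"
  by (simp add: W_def)

lemma f_cong: "(\<And>b. b \<in> B \<Longrightarrow> x \<bullet> b = y \<bullet> b) \<Longrightarrow> f x = f y"
  by (simp add: f_def)

lemma bounded_linear_P: "bounded_linear (P k)"
proof -
  have 1: "bounded_linear (\<lambda>x. (x \<bullet> e) *\<^sub>R e)"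
    by (rule bounded_linear_scaleR_const[OF bounded_linear_inner_left])
  then have 2: "bounded_linear (\<lambda>x. x - (x \<bullet> e) *\<^sub>R e)"
    by (rule bounded_linear_sub[OF bounded_linear_ident])
  have "P k = (if k = 1 then (\<lambda>x. (x \<bullet> e) *\<^sub>R e)
      else if k = 2 then (\<lambda>x. x - (x \<bullet> e) *\<^sub>R e) else (\<lambda>x. 0))"
    by (auto simp: P_def)
  then show ?thesis using 1 2 bounded_linear_zero by simp
qed

lemma V_cong_P:
  assumes eq: "P k x = P k y"
  shows "V k x = V k y"
proof -
  consider "k = 1" | "k = 2" | "k \<noteq> 1" "k \<noteq> 2" by blast
  then show ?thesis
  proof cases
    case 1
    then have "x \<bullet> e = y \<bullet> e" using eq nonzero_Basis[OF e] by (simp add: P_def)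
    with 1 show ?thesis by (simp add: V_def W_def)
  next
    case 2
    have "x \<bullet> b = y \<bullet> b" if "b \<in> B" for b
      using arg_cong[OF eq, of "\<lambda>v. v \<bullet> b"] 2 e_simps(2)[OF that]
      by (simp add: P_def inner_diff_left)
    then have "f x = f y" by (rule f_cong)
    with 2 show ?thesis by (simp add: V_def)
  qed (simp add: V_def)
qed

sublocale shears 5 V P
proof (rule shears.intro)
  show "bounded_linear (P k)" for k by (rule bounded_linear_P)
  show "P k (V k x) = 0" for k x by (simp add: P_def V_def)
  show "V k x = V k y" if "P k x = P k y" for k x y using that by (rule V_cong_P)
qed

lemma smooth_V: "smooth (V k)"
proof -
  have sq: "elementary (\<lambda>x::'a. (x \<bullet> b)\<^sup>2)" for b
    unfolding power2_eq_square by (intro elementary.mult elementary.inner)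
  have "smooth W"
    unfolding W_def[abs_def]
    by (intro smooth_sum_elementary elementary.exp elementary.mult elementary.const sq) simp
  moreover have "elementary f"
    using elementary.exp[OF elementary.mult[OF elementary.const[of "-1"]
        elementary_sum[of B, OF _ sq]]] by (simp add: f_def[abs_def])
  then have "smooth (\<lambda>x. f x *\<^sub>R e)" using smooth_sum_elementary[of "{e}" "\<lambda>b. f" id] by simp
  moreover have "smooth (\<lambda>x::'a. c)" for c :: 'a
    using smooth_sum_elementary[of "{c}" "\<lambda>b x. 1" id] by (simp add: elementary.const)
  moreover have "V k = (if k = 0 then (\<lambda>x. e) else if k = 1 then W
      else if k = 2 then (\<lambda>x. f x *\<^sub>R e) else (\<lambda>x. 0))"
    by (auto simp: V_def)
  ultimately show ?thesis by simp
qed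

lemma bounded_V: "bounded_field (V k)"
proof -
  have W: "norm (W x) \<le> real (card B)" for x
  proof -
    have "norm (W x) \<le> (\<Sum>b\<in>B. 1)"
      unfolding W_def using l_pos
      by (intro sum_norm_le) (auto simp: less_imp_le mult_nonneg_nonneg)
    then show ?thesis by simp
  qed
  have "\<bar>f x\<bar> \<le> 1" for x by (simp add: f_def sum_nonneg)
  then have "norm (V k x) \<le> real (card B) + 1" for x
    using W[of x] e by (auto simp: V_def add_increasing simp del: card_Diff_insert)
  then show ?thesis unfolding bounded_field_def bounded_iff by blast
qed

subsection \<open>Steering finitely many points\<close>

lemma shift_e: "flow_group 5 V (\<lambda>x. x + t *\<^sub>R e)"
  using flow_group.flow[of 0 5 V t] by (simp add: V_def)

lemma flow_W: "flow_group 5 V (\<lambda>x. x + t *\<^sub>R W x)"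
  using flow_group.flow[of 1 5 V t] by (simp add: V_def)

lemma flow_f: "flow_group 5 V (\<lambda>x. x + t *\<^sub>R f x *\<^sub>R e)"
  using flow_group.flow[of 2 5 V t] by (simp add: V_def)

text \<open>Gaussian translates interpolate any data on the finite set of pairs in
  \<open>A \<times> B\<close>, by their independence; the pair \<open>(a, b)\<close> carries the
  \<open>b\<close>-component of the displacement at height \<open>a\<close>.\<close>

lemma shift_transversal:
  assumes "finite A" and \<tau>: "\<And>a. a \<in> A \<Longrightarrow> \<tau> a \<bullet> e = 0"
  shows "\<exists>F. flow_group 5 V F \<and> (\<forall>x. x \<bullet> e \<in> A \<longrightarrow> F x = x + \<tau> (x \<bullet> e))"
proof -
  \<comment> \<open>All multiples \<open>s\<close> are demanded so that \<open>R\<close> is closed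
    under scaling.\<close>
  define R where "R h \<longleftrightarrow> (\<forall>s. \<exists>F. flow_group 5 V F \<and>
      (\<forall>x. F x = x + s *\<^sub>R (\<Sum>b\<in>B. h (x \<bullet> e, b) *\<^sub>R b)))" for h :: "real \<times> 'a \<Rightarrow> real"
  have "\<exists>h. R h \<and> (\<forall>p\<in>A \<times> B. h p = \<tau> (fst p) \<bullet> snd p)"
  proof (rule interpolation_of_independent[where \<phi> = "\<lambda>p c. exp (- l (snd p) * (fst p + c)\<^sup>2)"])
    show "finite (A \<times> B)" using \<open>finite A\<close> by simp
  next
    fix c
    show "R (\<lambda>p. exp (- l (snd p) * (fst p + c)\<^sup>2))"
      unfolding R_def
    proof
      fix s
      show "\<exists>F. flow_group 5 V F \<and>
         (\<forall>x. F x = x + s *\<^sub>R (\<Sum>b\<in>B. exp (- l (snd (x \<bullet> e, b)) * (fst (x \<bullet> e, b) + c)\<^sup>2) *\<^sub>R b))"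
      proof (intro exI conjI allI)
        \<comment> \<open>Conjugation by the translation along \<open>e\<close> replaces the height
          \<open>x \<bullet> e\<close> by \<open>x \<bullet> e + c\<close> in the Gaussians.\<close>
        show "flow_group 5 V (\<lambda>x. (x + c *\<^sub>R e) + s *\<^sub>R W (x + c *\<^sub>R e) + (- c) *\<^sub>R e)"
          using flow_group.comp[OF flow_group.comp[OF shift_e flow_W] shift_e] .
      qed (simp add: W_def inner_add_left)
    qed
  next
    fix g h assume "R g" "R h"
    show "R (\<lambda>p. g p + h p)"
      unfolding R_def
    proof
      fix s
      obtain F where F: "flow_group 5 V F"
        "\<And>x. F x = x + s *\<^sub>R (\<Sum>b\<in>B. g (x \<bullet> e, b) *\<^sub>R b)" using \<open>R g\<close> unfolding R_def by blast
      obtain H where H: "flow_group 5 V H"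
        "\<And>x. H x = x + s *\<^sub>R (\<Sum>b\<in>B. h (x \<bullet> e, b) *\<^sub>R b)" using \<open>R h\<close> unfolding R_def by blast
      show "\<exists>F. flow_group 5 V F \<and>
         (\<forall>x. F x = x + s *\<^sub>R (\<Sum>b\<in>B. (g (x \<bullet> e, b) + h (x \<bullet> e, b)) *\<^sub>R b))"
        \<comment> \<open>\<open>F\<close> preserves the height on which the displacement of
          \<open>H\<close> depends, so the displacements add.\<close>
        by (intro exI conjI allI, rule flow_group.comp[OF F(1) H(1)])
          (simp add: F(2) H(2) inner_add_left scaleR_add_left scaleR_add_right sum.distrib)
    qed
  next
    fix r h assume "R h"
    show "R (\<lambda>p. r * h p)"
      unfolding R_def
    proof
      fix s
      show "\<exists>F. flow_group 5 V F \<and> (\<forall>x. F x = x + s *\<^sub>R (\<Sum>b\<in>B. (r * h (x \<bullet> e, b)) *\<^sub>R b))"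
        using \<open>R h\<close>[unfolded R_def, rule_format, of "s * r"]
        by (simp add: scaleR_sum_right mult.assoc)
    qed
  next
    fix \<mu> assume zero: "\<And>c. (\<Sum>p\<in>A \<times> B. \<mu> p * exp (- l (snd p) * (fst p + c)\<^sup>2)) = 0"
    have inj: "inj_on l (snd ` (A \<times> B))" by (rule inj_on_subset[OF inj_l]) auto
    have pos: "0 < l (snd p)" if "p \<in> A \<times> B" for p using that l_pos by auto
    have "finite (A \<times> B)" using \<open>finite A\<close> by simp
    then show "\<forall>p\<in>A \<times> B. \<mu> p = 0"
      using gauss_translates_independent[OF _ inj pos zero] by simp
  qed
  then obtain h where h: "R h" "\<And>a b. a \<in> A \<Longrightarrow> b \<in> B \<Longrightarrow> h (a, b) = \<tau> a \<bullet> b" by fastforce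
  obtain F where F: "flow_group 5 V F" "\<And>x. F x = x + (\<Sum>b\<in>B. h (x \<bullet> e, b) *\<^sub>R b)"
    using h(1)[unfolded R_def, rule_format, of 1] by auto
  have "F x = x + \<tau> (x \<bullet> e)" if "x \<bullet> e \<in> A" for x
    using F(2)[of x] h(2)[OF that] decomp[of "\<tau> (x \<bullet> e)"] \<tau>[OF that] by simp
  then show ?thesis using F(1) by blast
qed

text \<open>Induction on the number of ordered pairs sharing a height: a transversal shift gives one
  such pair different values of \<open>f\<close>, and a generic time of the flow of
  \<open>f e\<close> separates it without creating new coincidences.\<close>

lemma separate:
  assumes "finite I" "inj_on x I"
  shows "\<exists>F. flow_group 5 V F \<and> inj_on (\<lambda>i. F (x i) \<bullet> e) I"
  using assms(2)
proof (induction "card {(i, j) \<in> I \<times> I. i \<noteq> j \<and> x i \<bullet> e = x j \<bullet> e}" arbitrary: x rule: less_induct)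
  case less
  define C where "C x = {(i, j) \<in> I \<times> I. i \<noteq> j \<and> x i \<bullet> e = x j \<bullet> e}" for x :: "_ \<Rightarrow> 'a"
  show ?case
  proof (cases "inj_on (\<lambda>i. x i \<bullet> e) I")
    case True
    then show ?thesis using shift_e[of 0] by (intro exI[of _ "\<lambda>x. x"]) simp
  next
    case False
    then obtain i j where ij: "i \<in> I" "j \<in> I" "i \<noteq> j" "x i \<bullet> e = x j \<bullet> e"
      by (auto simp: inj_on_def)
    \<comment> \<open>This shift puts \<open>x i\<close> on the axis through \<open>e\<close>, the
      only place where \<open>f\<close> equals 1.\<close>
    define w where "w = - (x i - (x i \<bullet> e) *\<^sub>R e)"
    have "w \<bullet> e = 0" by (simp add: w_def inner_diff_left)
    then have "\<exists>F. flow_group 5 V F \<and> (\<forall>y. y \<bullet> e \<in> (\<lambda>k. x k \<bullet> e) ` I \<longrightarrow> F y = y + w)"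
      using \<open>finite I\<close> by (intro shift_transversal[of _ "\<lambda>_. w"]) auto
    then obtain F where F: "flow_group 5 V F" "\<And>k. k \<in> I \<Longrightarrow> F (x k) = x k + w" by blast
    have fi: "f (x i + w) = 1"
      by (simp add: f_def w_def inner_add_left inner_diff_left)
    have fj: "f (x j + w) < 1"
    proof (rule ccontr)
      assume "\<not> ?thesis"
      then have "(\<Sum>b\<in>B. ((x j + w) \<bullet> b)\<^sup>2) \<le> 0" by (simp add: f_def)
      then have "(\<Sum>b\<in>B. ((x j + w) \<bullet> b)\<^sup>2) = 0" by (intro antisym sum_nonneg) auto
      then have "\<forall>b\<in>B. (x j + w) \<bullet> b = 0" by (subst (asm) sum_nonneg_eq_0_iff) auto
      then have "x j \<bullet> b = x i \<bullet> b" if "b \<in> B" for b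
        using that by (simp add: w_def inner_add_left inner_diff_left)
      then have "x j = x i" using decomp[of "x j"] decomp[of "x i"] ij(4) by simp
      then show False using less.prems ij by (auto dest: inj_onD)
    qed
    \<comment> \<open>Times at which two points of different heights would meet. Time 0 is excluded
      too, since it would not part \<open>i\<close> and \<open>j\<close>.\<close>
    define bad where "bad = (\<lambda>(k, m). (x m \<bullet> e - x k \<bullet> e) / (f (x k + w) - f (x m + w))) ` (I \<times> I)"
    have "finite (insert 0 bad)" using \<open>finite I\<close> by (simp add: bad_def)
    then obtain t where t: "t \<notin> insert 0 bad" using ex_new_if_finite infinite_UNIV_char_0 by blast
    define H where "H = (\<lambda>z. F z + t *\<^sub>R f (F z) *\<^sub>R e)"
    have H: "flow_group 5 V H" unfolding H_def using flow_group.comp[OF F(1) flow_f] .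
    define x' where "x' = (\<lambda>k. H (x k))"
    have x'e: "x' k \<bullet> e = x k \<bullet> e + t * f (x k + w)" if "k \<in> I" for k
      using F(2)[OF that] \<open>w \<bullet> e = 0\<close> by (simp add: x'_def H_def inner_add_left)
    have keep: "x k \<bullet> e = x m \<bullet> e" if "k \<in> I" "m \<in> I" "x' k \<bullet> e = x' m \<bullet> e" for k m
    proof (rule ccontr)
      assume ne: "x k \<bullet> e \<noteq> x m \<bullet> e"
      have "t * (f (x k + w) - f (x m + w)) = x m \<bullet> e - x k \<bullet> e"
        using that x'e by (simp add: algebra_simps)
      with ne have "t = (x m \<bullet> e - x k \<bullet> e) / (f (x k + w) - f (x m + w))"
        by (metis eq_iff_diff_eq_0 mult_zero_right nonzero_mult_div_cancel_right)
      then have "t \<in> bad" unfolding bad_def using that by force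
      then show False using t by simp
    qed
    have "x' i \<bullet> e \<noteq> x' j \<bullet> e" using x'e ij t fi fj by simp
    then have "(i, j) \<in> C x" "(i, j) \<notin> C x'" using ij by (auto simp: C_def)
    moreover have "C x' \<subseteq> C x" by (auto simp: C_def dest: keep)
    ultimately have "C x' \<subset> C x" by blast
    moreover have "finite (C x)"
      by (rule finite_subset[of _ "I \<times> I"]) (use \<open>finite I\<close> in \<open>auto simp: C_def\<close>)
    ultimately have "card (C x') < card (C x)" by (rule psubset_card_mono[rotated])
    moreover have "inj_on x' I"
      using comp_inj_on[OF less.prems inj_on_subset[OF flow_group_inj[OF H]]]
      by (simp add: x'_def comp_def)
    ultimately obtain K where K: "flow_group 5 V K" "inj_on (\<lambda>i. K (x' i) \<bullet> e) I"
      using less.hyps[of x'] unfolding C_def by blast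
    then show ?thesis using flow_group.comp[OF H K(1)]
      by (intro exI[of _ "\<lambda>z. K (H z)"]) (simp add: x'_def)
  qed
qed

text \<open>Distinct heights label the points, so the required displacement becomes a function
  \<open>\<tau>\<close> of the height.\<close>

lemma steer_transversal:
  assumes "finite I" "inj_on (\<lambda>i. x i \<bullet> e) I" and eq: "\<And>i. i \<in> I \<Longrightarrow> x i \<bullet> e = z i \<bullet> e"
  shows "\<exists>F. flow_group 5 V F \<and> (\<forall>i\<in>I. F (x i) = z i)"
proof -
  let ?A = "(\<lambda>i. x i \<bullet> e) ` I"
  define \<tau> where "\<tau> a = (let i = the_inv_into I (\<lambda>i. x i \<bullet> e) a in z i - x i)" for a
  have \<tau>: "\<tau> (x i \<bullet> e) = z i - x i" if "i \<in> I" for i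
    using the_inv_into_f_f[OF assms(2) that] by (simp add: \<tau>_def)
  have "\<tau> a \<bullet> e = 0" if "a \<in> ?A" for a
    using that \<tau> eq by (auto simp: inner_diff_left)
  then obtain F where "flow_group 5 V F" "\<And>x. x \<bullet> e \<in> ?A \<Longrightarrow> F x = x + \<tau> (x \<bullet> e)"
    using shift_transversal[of ?A \<tau>] \<open>finite I\<close> by blast
  then show ?thesis using \<tau> by (intro exI[of _ F]) auto
qed

text \<open>A vector of squared length \<open>- ln c\<close> along a single direction in
  \<open>B\<close> suffices; the bound \<open>c \<le> 1\<close> makes this nonnegative.\<close>

lemma f_attains:
  assumes "0 < c" "c \<le> 1"
  shows "\<exists>r. f (a *\<^sub>R e + r) = c \<and> r \<bullet> e = 0"
proof -
  have "\<not> Basis \<subseteq> {e}"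
    using DIM_ge_2 card_mono[of "{e}" "Basis :: 'a set"] by auto
  then obtain b where b: "b \<in> B" by blast
  define r where "r = sqrt (- ln c) *\<^sub>R b"
  have "(a *\<^sub>R e + r) \<bullet> b' = (if b' = b then sqrt (- ln c) else 0)" if "b' \<in> B" for b'
    using that b by (auto simp: r_def inner_add_left inner_Basis)
  then have "(\<Sum>b'\<in>B. ((a *\<^sub>R e + r) \<bullet> b')\<^sup>2) = (\<Sum>b'\<in>B. if b' = b then (sqrt (- ln c))\<^sup>2 else 0)"
    by (intro sum.cong) auto
  also have "\<dots> = - ln c" using b assms by simp
  finally have "f (a *\<^sub>R e + r) = c" using assms by (simp add: f_def)
  moreover have "r \<bullet> e = 0" using b by (simp add: r_def)
  ultimately show ?thesis by blast
qed

text \<open>First a transversal move prescribes \<open>f\<close> at each point, then the flow of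
  \<open>f e\<close> and a translation bring the heights to their targets, and a second transversal
  move corrects the rest.\<close>

lemma steer_separated:
  assumes "finite I" "inj_on (\<lambda>i. x i \<bullet> e) I" "inj_on (\<lambda>i. z i \<bullet> e) I"
  shows "\<exists>F. flow_group 5 V F \<and> (\<forall>i\<in>I. F (x i) = z i)"
proof -
  define \<delta> where "\<delta> i = z i \<bullet> e - x i \<bullet> e" for i
  \<comment> \<open>The summand 1 makes \<open>M\<close> positive and larger than every
    \<open>\<bar>\<delta> i\<bar>\<close>. Then \<open>(\<delta> i + M) / (2 * M)\<close> is an
    admissible value of \<open>f\<close>, and flowing for \<open>2 * M\<close> and shifting by
    \<open>- M\<close> moves the height by exactly \<open>\<delta> i\<close>.\<close>
  define M where "M = (\<Sum>i\<in>I. \<bar>\<delta> i\<bar>) + 1"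
  have le: "\<bar>\<delta> i\<bar> < M" if "i \<in> I" for i
    using member_le_sum[of i I "\<lambda>i. \<bar>\<delta> i\<bar>"] that \<open>finite I\<close> by (simp add: M_def)
  have "M > 0" unfolding M_def by (smt (verit) sum_nonneg abs_ge_zero)
  have "\<exists>r. f ((x i \<bullet> e) *\<^sub>R e + r) = (\<delta> i + M) / (2 * M) \<and> r \<bullet> e = 0" if "i \<in> I" for i
    using le[OF that] \<open>M > 0\<close> by (intro f_attains) (auto simp: field_simps)
  then obtain r where r: "\<And>i. i \<in> I \<Longrightarrow> f ((x i \<bullet> e) *\<^sub>R e + r i) = (\<delta> i + M) / (2 * M)"
    "\<And>i. i \<in> I \<Longrightarrow> r i \<bullet> e = 0" by metis
  define x1 where "x1 i = (x i \<bullet> e) *\<^sub>R e + r i" for i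
  have x1: "x i \<bullet> e = x1 i \<bullet> e" if "i \<in> I" for i
    using r(2)[OF that] by (simp add: x1_def inner_add_left)
  obtain F where F: "flow_group 5 V F" "\<And>i. i \<in> I \<Longrightarrow> F (x i) = x1 i"
    using steer_transversal[OF assms(1,2) x1] by blast
  define H where "H = (\<lambda>y. y + (2 * M) *\<^sub>R f y *\<^sub>R e + (- M) *\<^sub>R e)"
  have H: "flow_group 5 V H" unfolding H_def using flow_group.comp[OF flow_f shift_e] .
  have He: "H (x1 i) \<bullet> e = z i \<bullet> e" if "i \<in> I" for i
  proof -
    have "H (x1 i) \<bullet> e = x1 i \<bullet> e + 2 * M * f (x1 i) - M"
      by (simp add: H_def inner_add_left inner_diff_left)
    also have "f (x1 i) = (\<delta> i + M) / (2 * M)" using r(1)[OF that] by (simp add: x1_def)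
    also have "x1 i \<bullet> e + 2 * M * ((\<delta> i + M) / (2 * M)) - M = x i \<bullet> e + \<delta> i"
      using \<open>M > 0\<close> x1[OF that] by simp
    also have "\<dots> = z i \<bullet> e" using \<open>M > 0\<close> by (simp add: \<delta>_def)
    finally show ?thesis .
  qed
  have "inj_on (\<lambda>i. H (x1 i) \<bullet> e) I" using assms(3) He by (simp cong: inj_on_cong)
  then obtain K where K: "flow_group 5 V K" "\<And>i. i \<in> I \<Longrightarrow> K (H (x1 i)) = z i"
    using steer_transversal[of I "\<lambda>i. H (x1 i)" z] assms(1) He by blast
  show ?thesis
    using flow_group.comp[OF flow_group.comp[OF F(1) H] K(1)] F(2) K(2) by (intro exI conjI) auto
qed

text \<open>Sources and targets are separated by \<open>F\<close> and \<open>H\<close>, the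
  separated configurations are joined by \<open>K\<close>, and \<open>H\<close> is undone at the
  end.\<close>

lemma flow_group_transitive:
  assumes "finite I" "inj_on x I" "inj_on y I"
  shows "\<exists>F. flow_group 5 V F \<and> (\<forall>i\<in>I. F (x i) = y i)"
proof -
  obtain F where F: "flow_group 5 V F" "inj_on (\<lambda>i. F (x i) \<bullet> e) I"
    using separate[OF assms(1,2)] by blast
  obtain H where H: "flow_group 5 V H" "inj_on (\<lambda>i. H (y i) \<bullet> e) I"
    using separate[OF assms(1,3)] by blast
  obtain H' where H': "flow_group 5 V H'" "\<And>x. H' (H x) = x"
    using flow_group_left_inverse[OF H(1)] by blast
  obtain K where K: "flow_group 5 V K" "\<And>i. i \<in> I \<Longrightarrow> K (F (x i)) = H (y i)"
    using steer_separated[OF assms(1) F(2) H(2)] by blast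
  show ?thesis
    using flow_group.comp[OF flow_group.comp[OF F(1) K(1)] H'(1)] K(2) H'(2)
    by (intro exI conjI) auto
qed

lemma universal_interpolator_V: "universal_interpolator 5 V N \<Omega>"
proof (rule universal_interpolator_if_realizable)
  fix x y :: "nat \<Rightarrow> 'a" assume "inj_on x {..<N}" "inj_on y {..<N}"
  then obtain F where "flow_group 5 V F" "\<forall>i\<in>{..<N}. F (x i) = y i"
    using flow_group_transitive[OF finite_lessThan] by blast
  then show "\<exists>F. realizable 5 V F \<and> (\<forall>i<N. F (x i) = y i)"
    using flow_group_realizable by (intro exI[of _ F]) auto
qed

end

theorem theorem1:
  fixes \<Omega> :: "(real ^ 'm) set"
  assumes "CARD('m) \<ge> 2"
    and "bounded \<Omega>" and "open \<Omega>" and "connected \<Omega>"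
  shows "\<exists>V :: nat \<Rightarrow> real ^ 'm \<Rightarrow> real ^ 'm.
           (\<forall>i<5. smooth (V i) \<and> bounded_field (V i)) \<and>
           (\<forall>N. universal_interpolator 5 V N \<Omega>)"
proof -
  obtain e :: "real ^ 'm" where e: "e \<in> Basis" using nonempty_Basis by blast
  \<comment> \<open>An injective numbering of the basis; its successor values serve as distinct
    positive decay rates.\<close>
  obtain \<nu> :: "real ^ 'm \<Rightarrow> nat" where \<nu>: "inj_on \<nu> Basis"
    using finite_imp_inj_to_nat_seg[OF finite_Basis] by blast
  interpret gauss_fields e "\<lambda>b. real (Suc (\<nu> b))"
    using e \<nu> assms(1) by unfold_locales (auto simp: inj_on_def)
  show ?thesis using smooth_V bounded_V universal_interpolator_V by blast
qed

end
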